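(* Let $M\ge2$ be an integer. Let $X=(X(t))_{t\in\mathbb{R}}$ be a real, centred, second-order strictly stationary random process, continuous in quadratic mean, with finite cumulants of all orders. Assume that, for every natural number $N\ge1$, the polyspectrum $\gamma_N$ of $X$ belongs to $L^{\infty}(\mathbb{R}^N)$, and that the spectrum $\gamma=\gamma_1$ is supported within $[-\pi,\pi]$. For each order $r\in\mathbb{N}$ let $(h^{[r]}_m)_{0\le m\le M-1}$ be a family of real paraunitary $M$-band filters with frequency responses $H^{[r]}_m$ such that, for every $m\in\{0,\ldots,M-1\}$, $\lim_{r\to\infty}H^{[r]}_m=H^{S}_m$ almost everywhere, where $H^S_m$ are the Shannon filters. For every natural number $j$ and every $n\in\{0,1,\ldots,M^j-1\}$, let $\mathsf{cum}^{[r]}_{j,n}$ (resp. $\mathsf{cum}^{S}_{j,n}$) stand for the cumulant of order $N+1$ of the wavelet packet coefficients of $X$ at node $(j,n)$ of the $M$-band wavelet packet decomposition of the Paley–Wiener space (functions of $L^2(\mathbb{R})$ with Fourier transform supported in $[-\pi,\pi]$) achieved with the filters $h^{[r]}_m$ (resp. with the Shannon filters). Then, for every natural number $j$ and every $N\ge 1$, $$\lim_{r\to+\infty}\mathsf{cum}^{[r]}_{j,n}[k_1,k_2,\ldots,k_N]=\mathsf{cum}^{S}_{j,n}[k_1,k_2,\ldots,k_N],$$ uniformly in $n\in\{0,\ldots,M^j-1\}$ and $k_1,k_2,\ldots,k_N\in\mathbb{Z}$.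
   Context: Fourier transform: $\mathcal{F}f(\omega)=\int_{\mathbb{R}} f(t)e^{-i\omega t}\,dt$, and similarly on $\mathbb{R}^N$. By strict stationarity the joint cumulant of order $N+1$ of $X(t),X(t+t_1),\ldots,X(t+t_N)$ depends only on $(t_1,\ldots,t_N)$ and is denoted $\mathsf{cum}(t_1,\ldots,t_N)$; the polyspectrum $\gamma_N(\omega_1,\ldots,\omega_N)$ is its Fourier transform (assumed to exist). For $N=1$, $\gamma_1=\gamma$ is the spectrum of $X$, i.e. the Fourier transform of its autocorrelation function. Filters: a filter $h_m$ has frequency response $H_m(\omega)=\frac{1}{\sqrt{M}}\sum_{\ell\in\mathbb{Z}}h_m[\ell]e^{-i\ell\omega}$. A family $(h_m)_{0\le m\le M-1}$ is paraunitary if for a.e. $\omega$ the $M\times M$ matrix $\big(H_m(\omega+2\pi q/M)\big)_{0\le m,q\le M-1}$ is unitary; in particular $|H_m|\le 1$ a.e. The Shannon filters are given by $H^{S}_m(\omega)=\sum_{\ell\in\mathbb{Z}}\mathbf{1}_{\Delta_m}(\omega-2\pi\ell)$ with $\Delta_m=\left[-\frac{(m+1)\pi}{M},-\frac{m\pi}{M}\right]\cup\left[\frac{m\pi}{M},\frac{(m+1)\pi}{M}\right]$. Wavelet packet functions: for a family of filters with frequency responses $H_m$ (either $H_m=H^{[r]}_m$ or $H_m=H^{S}_m$) and $n=\sum_{\ell=1}^{j}m_\ell M^{j-\ell}\in\{0,\ldots,M^j-1\}$ with $m_\ell\in\{0,\ldots,M-1\}$, the function $W_{j,n}\in L^2(\mathbb{R})$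 (denoted $W^{[r]}_{j,n}$, resp. $W^{S}_{j,n}$) has Fourier transform $$\mathcal{F}W_{j,n}(\omega)=M^{j/2}\Big[\prod_{\ell=1}^{j}H_{m_\ell}(M^{\ell-1}\omega)\Big]\mathbf{1}_{[-\pi,\pi]}(\omega),$$ and $W_{j,n,k}(t)=W_{j,n}(t-M^jk)$ for $k\in\mathbb{Z}$. The coefficients at node $(j,n)$ are $c_{j,n}[k]=\int_{\mathbb{R}}X(t)W_{j,n,k}(t)\,dt$, $k\in\mathbb{Z}$ (the integrals are assumed to exist). The process $(c_{j,n}[k])_k$ is strictly stationary, and $\mathsf{cum}_{j,n}[k_1,\ldots,k_N]$ denotes the joint cumulant of $c_{j,n}[k],c_{j,n}[k+k_1],\ldots,c_{j,n}[k+k_N]$ (independent of $k$). It is given by (standing convention) $$\mathsf{cum}_{j,n}[k_1,\ldots,k_N]=\frac{1}{(2\pi)^N}\int_{\mathbb{R}^N}e^{-iM^j(k_1\omega_1+\cdots+k_N\omega_N)}\gamma_N(-\omega_1,\ldots,-\omega_N)\,\mathcal{F}W_{j,n}(-\omega_1-\cdots-\omega_N)\prod_{q=1}^{N}\mathcal{F}W_{j,n}(\omega_q)\,d\omega_1\cdots d\omega_N ,$$ with $W_{j,n}=W^{[r]}_{j,n}$ for $\mathsf{cum}^{[r]}_{j,n}$ and $W_{j,n}=W^{S}_{j,n}$ for $\mathsf{cum}^{S}_{j,n}$. *)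

theory Defs
  imports "HOL-Probability.Probability" "HOL-Library.Disjoint_Sets"
begin

definition joint_cumulant :: "'a measure \<Rightarrow> 'i set \<Rightarrow> ('i \<Rightarrow> 'a \<Rightarrow> real) \<Rightarrow> real" where
  "joint_cumulant P I Y =
     (\<Sum>\<pi> | partition_on I \<pi>.
        (- 1) ^ (card \<pi> - 1) * fact (card \<pi> - 1) *
        (\<Prod>B\<in>\<pi>. \<integral>x. (\<Prod>i\<in>B. Y i x) \<partial>P))"

text \<open>All joint moments are finite, so that every expectation occurring in a joint cumulant
  of variables of the process (possibly with repetitions) is a genuine one.\<close>

definition finite_cumulants :: "'a measure \<Rightarrow> ('t \<Rightarrow> 'a \<Rightarrow> real) \<Rightarrow> bool" where
  "finite_cumulants P Y \<longleftrightarrow>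
     (\<forall>(m::nat) t. integrable P (\<lambda>x. \<Prod>i<m. Y (t i) x))"

text \<open>The cumulant of order \<open>N + 1\<close> of \<open>Y 0, Y (t 0), \<dots>, Y (t (N - 1))\<close>. For a strictly
  stationary process the base time \<open>0\<close> is immaterial. It is used for processes indexed by real as
  well as by integer times; of \<open>t\<close> only the values below \<open>N\<close> matter.\<close>

definition lag_cumulant ::
    "'a measure \<Rightarrow> ('t::zero \<Rightarrow> 'a \<Rightarrow> real) \<Rightarrow> nat \<Rightarrow> (nat \<Rightarrow> 't) \<Rightarrow> real" where
  "lag_cumulant P Y N t =
     joint_cumulant P {..N} (\<lambda>i. Y (case i of 0 \<Rightarrow> 0 | Suc q \<Rightarrow> t q))"

definition strictly_stationary :: "'a measure \<Rightarrow> (real \<Rightarrow> 'a \<Rightarrow> real) \<Rightarrow> bool" where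
  "strictly_stationary P X \<longleftrightarrow>
     (\<forall>(m::nat) t h.
        distr P (Pi\<^sub>M {..<m} (\<lambda>_. borel)) (\<lambda>x. \<lambda>i\<in>{..<m}. X (t i + h) x) =
        distr P (Pi\<^sub>M {..<m} (\<lambda>_. borel)) (\<lambda>x. \<lambda>i\<in>{..<m}. X (t i) x))"

definition second_order_process :: "'a measure \<Rightarrow> (real \<Rightarrow> 'a \<Rightarrow> real) \<Rightarrow> bool" where
  "second_order_process P X \<longleftrightarrow>
     (\<forall>t. X t \<in> borel_measurable P \<and> integrable P (\<lambda>x. (X t x)\<^sup>2))"

definition centred :: "'a measure \<Rightarrow> (real \<Rightarrow> 'a \<Rightarrow> real) \<Rightarrow> bool" where
  "centred P X \<longleftrightarrow> (\<forall>t. (\<integral>x. X t x \<partial>P) = 0)"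

definition continuous_in_quadratic_mean :: "'a measure \<Rightarrow> (real \<Rightarrow> 'a \<Rightarrow> real) \<Rightarrow> bool" where
  "continuous_in_quadratic_mean P X \<longleftrightarrow>
     (\<forall>t. ((\<lambda>s. \<integral>x. (X s x - X t x)\<^sup>2 \<partial>P) \<longlongrightarrow> 0) (at t))"

text \<open>Integrals of a process are quadratic-mean limits of Riemann sums on compact intervals,
  and quadratic-mean limits of these (improper integrals) on the whole line. Pathwise Lebesgue
  integrals would not do, since the analysing functions below are in general not absolutely
  integrable.\<close>

definition has_qm_integral_on ::
    "'a measure \<Rightarrow> (real \<Rightarrow> 'a \<Rightarrow> real) \<Rightarrow> real \<Rightarrow> real \<Rightarrow> ('a \<Rightarrow> real) \<Rightarrow> bool" where
  "has_qm_integral_on P Y a b J \<longleftrightarrow>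
     J \<in> borel_measurable P \<and>
     (\<forall>e>0. \<exists>d>0. \<forall>p. p tagged_division_of {a..b} \<and> (\<lambda>t. ball t d) fine p \<longrightarrow>
        (\<integral>\<^sup>+x. ennreal (((\<Sum>(t, K)\<in>p. measure lborel K * Y t x) - J x)\<^sup>2) \<partial>P) < ennreal e)"

definition has_qm_integral ::
    "'a measure \<Rightarrow> (real \<Rightarrow> 'a \<Rightarrow> real) \<Rightarrow> ('a \<Rightarrow> real) \<Rightarrow> bool" where
  "has_qm_integral P Y c \<longleftrightarrow>
     c \<in> borel_measurable P \<and>
     (\<exists>J. (\<forall>a b. a \<le> b \<longrightarrow> has_qm_integral_on P Y a b (J a b)) \<and>
          ((\<lambda>(a, b). \<integral>\<^sup>+x. ennreal ((J a b x - c x)\<^sup>2) \<partial>P) \<longlongrightarrow> 0) (at_bot \<times>\<^sub>F at_top))"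

text \<open>\<open>\<real>\<^sup>N\<close> with Lebesgue measure; vectors are extensional functions on \<open>{..<N}\<close>.\<close>

abbreviation lborel_pow :: "nat \<Rightarrow> (nat \<Rightarrow> real) measure" where
  "lborel_pow N \<equiv> Pi\<^sub>M {..<N} (\<lambda>_. lborel)"

definition fourier_integral :: "nat \<Rightarrow> ((nat \<Rightarrow> real) \<Rightarrow> complex) \<Rightarrow> (nat \<Rightarrow> real) \<Rightarrow> complex" where
  "fourier_integral N f w =
     (\<integral>t. f t * exp (- \<i> * complex_of_real (\<Sum>q<N. t q * w q)) \<partial>lborel_pow N)"

text \<open>\<open>g\<close> is the Fourier transform of \<open>f\<close> in the sense of duality (the multiplication formula),
  which for bounded \<open>f\<close> and \<open>g\<close> is the Fourier transform of tempered distributions. If \<open>f\<close> is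
  integrable, this means that \<open>g\<close> is almost everywhere equal to \<open>fourier_integral N f\<close>; but a
  spectrum such as the indicator function of an interval, whose autocorrelation function is not
  absolutely integrable, is covered as well.\<close>

definition has_fourier_transform ::
    "nat \<Rightarrow> ((nat \<Rightarrow> real) \<Rightarrow> complex) \<Rightarrow> ((nat \<Rightarrow> real) \<Rightarrow> complex) \<Rightarrow> bool" where
  "has_fourier_transform N f g \<longleftrightarrow>
     (\<forall>\<phi>. integrable (lborel_pow N) \<phi> \<and> integrable (lborel_pow N) (fourier_integral N \<phi>) \<longrightarrow>
        integrable (lborel_pow N) (\<lambda>t. f t * fourier_integral N \<phi> t) \<and>
        integrable (lborel_pow N) (\<lambda>w. g w * \<phi> w) \<and>
        (\<integral>t. f t * fourier_integral N \<phi> t \<partial>lborel_pow N) = (\<integral>w. g w * \<phi> w \<partial>lborel_pow N))"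

definition is_polyspectrum ::
    "'a measure \<Rightarrow> (real \<Rightarrow> 'a \<Rightarrow> real) \<Rightarrow> nat \<Rightarrow> ((nat \<Rightarrow> real) \<Rightarrow> complex) \<Rightarrow> bool" where
  "is_polyspectrum P X N g \<longleftrightarrow>
     has_fourier_transform N (\<lambda>t. complex_of_real (lag_cumulant P X N t)) g"

definition in_L_infinity :: "'b measure \<Rightarrow> ('b \<Rightarrow> complex) \<Rightarrow> bool" where
  "in_L_infinity M g \<longleftrightarrow> g \<in> borel_measurable M \<and> (\<exists>C. AE w in M. cmod (g w) \<le> C)"

text \<open>The series of the frequency response converges in quadratic mean on bounded intervals, which
  determines \<open>H\<close> almost everywhere and does not require the filter to be absolutely summable.\<close>

definition frequency_response :: "nat \<Rightarrow> (int \<Rightarrow> real) \<Rightarrow> (real \<Rightarrow> complex) \<Rightarrow> bool" where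
  "frequency_response M h H \<longleftrightarrow>
     H \<in> borel_measurable borel \<and>
     (\<forall>a b. ((\<lambda>L::nat. \<integral>\<^sup>+w\<in>{a..b}.
          ennreal ((cmod (H w - complex_of_real (1 / sqrt (real M)) *
            (\<Sum>l\<in>{- int L..int L}. complex_of_real (h l) *
               exp (- \<i> * complex_of_real (of_int l * w)))))\<^sup>2) \<partial>lborel) \<longlonglongrightarrow> 0))"

definition unitary_matrix :: "nat \<Rightarrow> (nat \<Rightarrow> nat \<Rightarrow> complex) \<Rightarrow> bool" where
  "unitary_matrix M U \<longleftrightarrow>
     (\<forall>m<M. \<forall>m'<M. (\<Sum>q<M. U m q * cnj (U m' q)) = (if m = m' then 1 else 0)) \<and>
     (\<forall>q<M. \<forall>q'<M. (\<Sum>m<M. cnj (U m q) * U m q') = (if q = q' then 1 else 0))"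

definition paraunitary :: "nat \<Rightarrow> (nat \<Rightarrow> real \<Rightarrow> complex) \<Rightarrow> bool" where
  "paraunitary M H \<longleftrightarrow>
     (AE w in lborel. unitary_matrix M (\<lambda>m q. H m (w + 2 * pi * real q / real M)))"

definition shannon_band :: "nat \<Rightarrow> nat \<Rightarrow> real set" where
  "shannon_band M m =
     {- (real (m + 1) * pi / real M) .. - (real m * pi / real M)} \<union>
     {real m * pi / real M .. real (m + 1) * pi / real M}"

text \<open>For each \<open>w\<close> the sum below has only finitely many nonzero terms.\<close>

definition shannon :: "nat \<Rightarrow> nat \<Rightarrow> real \<Rightarrow> complex" where
  "shannon M m w = (\<Sum>\<^sub>\<infinity>l::int. indicator (shannon_band M m) (w - 2 * pi * of_int l))"

text \<open>The digit \<open>m\<^sub>l\<close> (for \<open>1 \<le> l \<le> j\<close>) in \<open>n = (\<Sum>l=1..j. m\<^sub>l * M ^ (j - l))\<close>.\<close>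

definition packet_digit :: "nat \<Rightarrow> nat \<Rightarrow> nat \<Rightarrow> nat \<Rightarrow> nat" where
  "packet_digit M j n l = n div M ^ (j - l) mod M"

definition packet_FT :: "nat \<Rightarrow> (nat \<Rightarrow> real \<Rightarrow> complex) \<Rightarrow> nat \<Rightarrow> nat \<Rightarrow> real \<Rightarrow> complex" where
  "packet_FT M H j n w =
     complex_of_real (real M powr (real j / 2)) *
     (\<Prod>l=1..j. H (packet_digit M j n l) (real (M ^ (l - 1)) * w)) *
     indicator {- pi..pi} w"

text \<open>The function with Fourier transform \<open>packet_FT M H j n\<close>, given by the inversion formula (its
  continuous representative). For real filters the integral is real, so that taking the real part
  only adjusts the type.\<close>

definition packet :: "nat \<Rightarrow> (nat \<Rightarrow> real \<Rightarrow> complex) \<Rightarrow> nat \<Rightarrow> nat \<Rightarrow> real \<Rightarrow> real" where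
  "packet M H j n t =
     Re (complex_of_real (1 / (2 * pi)) *
         (\<integral>w. packet_FT M H j n w * exp (\<i> * complex_of_real (w * t)) \<partial>lborel))"

definition packet_coefficients ::
    "'a measure \<Rightarrow> (real \<Rightarrow> 'a \<Rightarrow> real) \<Rightarrow> nat \<Rightarrow> (nat \<Rightarrow> real \<Rightarrow> complex) \<Rightarrow>
     nat \<Rightarrow> nat \<Rightarrow> (int \<Rightarrow> 'a \<Rightarrow> real) \<Rightarrow> bool" where
  "packet_coefficients P X M H j n c \<longleftrightarrow>
     (\<forall>k. has_qm_integral P (\<lambda>t x. X t x * packet M H j n (t - of_int (int (M ^ j) * k))) (c k))"

text \<open>The spectral expression, in terms of the polyspectrum \<open>g\<close> of order \<open>N\<close>, of the cumulants of
  the coefficients at a node.\<close>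

definition packet_cumulant_integral ::
    "nat \<Rightarrow> (nat \<Rightarrow> real \<Rightarrow> complex) \<Rightarrow> nat \<Rightarrow> nat \<Rightarrow> nat \<Rightarrow> ((nat \<Rightarrow> real) \<Rightarrow> complex) \<Rightarrow>
     (nat \<Rightarrow> int) \<Rightarrow> complex" where
  "packet_cumulant_integral M H j n N g k =
     complex_of_real (1 / (2 * pi) ^ N) *
     (\<integral>w. exp (- \<i> * complex_of_real (real (M ^ j) * (\<Sum>q<N. of_int (k q) * w q))) *
           g (\<lambda>q\<in>{..<N}. - w q) *
           packet_FT M H j n (- (\<Sum>q<N. w q)) *
           (\<Prod>q<N. packet_FT M H j n (w q)) \<partial>lborel_pow N)"

end

theory Submission
  imports Defs
begin

text \<open>Every \<open>packet_FT M (H r) j n\<close> is bounded by \<open>M powr (j / 2)\<close> on \<open>{- pi..pi}\<close> and vanishes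
  outside, because the entries of a unitary matrix have modulus at most 1. The difference of two
  cumulants is therefore at most a constant times the integral over the cube of the difference of
  the products of these transforms; the phase carrying \<open>k\<close> has modulus 1 and disappears. This
  integral tends to 0 by dominated convergence, and there are only finitely many nodes at level
  \<open>j\<close>.\<close>

section \<open>Null sets under affine maps, linear forms and reflections\<close>

text \<open>The substitution \<open>t + c * x\<close> changes Lebesgue measure only by the factor
  \<open>\<bar>c\<bar>\<close>, so the preimage of the exceptional null set is null.\<close>

lemma AE_lborel_affine:
  fixes Q :: "real \<Rightarrow> bool"
  assumes Q: "AE x in lborel. Q x" and c: "c \<noteq> 0"
  shows "AE x in lborel. Q (t + c * x)"
proof -
  obtain B where B: "{x \<in> space lborel. \<not> Q x} \<subseteq> B" "emeasure lborel B = 0" "B \<in> sets lborel"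
    using Q by (rule AE_E)
  have "B \<in> sets borel" using B(3) by simp
  note ind = borel_measurable_indicator[OF this, where 'b = ennreal]
  have "(\<integral>\<^sup>+x. indicator B x \<partial>lborel) =
      ennreal \<bar>c\<bar> * (\<integral>\<^sup>+x. indicator B (t + c * x) \<partial>lborel)"
    by (rule nn_integral_real_affine[OF ind c])
  \<comment> \<open>The left side is the measure of \<open>B\<close>, hence 0, and
    \<open>c \<noteq> 0\<close> lets the factor be cancelled.\<close>
  then have "(\<integral>\<^sup>+x. indicator B (t + c * x) \<partial>lborel) = 0"
    by (simp only: nn_integral_indicator[OF B(3)] B(2)) (use c in simp)
  moreover have "(\<lambda>x. indicator B (t + c * x) :: ennreal) \<in> borel_measurable lborel"
    by (rule measurable_compose[OF _ ind]) measurable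
  ultimately have "AE x in lborel. indicator B (t + c * x) = (0 :: ennreal)"
    by (simp only: nn_integral_0_iff_AE)
  then show ?thesis
    by eventually_elim (use B(1) in \<open>auto split: split_indicator_asm\<close>)
qed

interpretation lborel_product: product_sigma_finite "\<lambda>_. lborel :: real measure"
  by unfold_locales

text \<open>Fubini: once the other coordinates are fixed, the linear form is affine in coordinate
  \<open>i\<close> with nonzero slope, so every slice of the exceptional set is null. This carries
  one-dimensional a.e. facts over to the arguments at which the packet transforms are evaluated in
  the cumulant integral.\<close>

lemma AE_lborel_pow_linear:
  fixes Q :: "real \<Rightarrow> bool" and a :: "nat \<Rightarrow> real"
  assumes Q: "AE x in lborel. Q x" and i: "i < N" and a: "a i \<noteq> 0"
  shows "AE w in lborel_pow N. Q (\<Sum>q<N. a q * w q)"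
proof -
  obtain B where B: "{x \<in> space lborel. \<not> Q x} \<subseteq> B" "emeasure lborel B = 0" "B \<in> sets lborel"
    using Q by (rule AE_E)
  have "B \<in> sets borel" using B(3) by simp
  note ind = borel_measurable_indicator[OF this, where 'b = ennreal]
  note [measurable] = measurable_compose[OF _ ind]
  let ?I = "{..<N} - {i}"
  have N: "insert i ?I = {..<N}" using i by auto
  have meas: "(\<lambda>w. indicator B (\<Sum>q<N. a q * w q) :: ennreal) \<in> borel_measurable (lborel_pow N)"
    by measurable
  have inner: "(\<integral>\<^sup>+y. indicator B (\<Sum>q<N. a q * (x(i := y)) q) \<partial>lborel) = (0 :: ennreal)" for x
  proof -
    have eq: "(\<Sum>q<N. a q * (x(i := y)) q) = (\<Sum>q\<in>?I. a q * x q) + a i * y" for y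
      using i by (subst sum.remove[of _ i]) (auto intro!: sum.cong)
    have "AE y in lborel. y \<notin> B"
      using B(2,3) by (intro AE_not_in) (auto simp: null_sets_def)
    from AE_lborel_affine[OF this a, of "\<Sum>q\<in>?I. a q * x q"]
    show ?thesis
      unfolding eq by (subst nn_integral_0_iff_AE) (measurable, auto)
  qed
  have "(\<integral>\<^sup>+w. indicator B (\<Sum>q<N. a q * w q) \<partial>lborel_pow N) = (0 :: ennreal)"
    using lborel_product.product_nn_integral_insert[of ?I i
        "\<lambda>w. indicator B (\<Sum>q<N. a q * w q)"] meas
    by (simp only: N inner) simp
  then have "AE w in lborel_pow N. indicator B (\<Sum>q<N. a q * w q) = (0 :: ennreal)"
    using meas by (subst (asm) nn_integral_0_iff_AE) auto
  then show ?thesis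
    by eventually_elim (use B(1) in \<open>auto split: split_indicator_asm\<close>)
qed

lemma AE_lborel_pow_component:
  fixes Q :: "real \<Rightarrow> bool"
  assumes "AE x in lborel. Q x" and "i < N"
  shows "AE w in lborel_pow N. Q (w i)"
proof -
  have "(\<Sum>q<N. (if q = i then 1 else 0) * w q) = w i" for w :: "nat \<Rightarrow> real"
    using assms(2) by (simp add: if_distrib[of "\<lambda>x. x * _"] cong: if_cong)
  with AE_lborel_pow_linear[OF assms(1), of i N "\<lambda>q. if q = i then 1 else 0"] assms(2)
  show ?thesis by simp
qed

lemma measurable_lborel_pow_uminus [measurable]:
  "(\<lambda>w. \<lambda>q\<in>{..<N}. - w q) \<in> lborel_pow N \<rightarrow>\<^sub>M lborel_pow N"
  by (rule measurable_restrict) measurable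

text \<open>A product measure is determined by its values on boxes, and reflecting a box reflects
  each side without changing its length. The reflection matters because the polyspectrum enters the
  cumulant formula at negated frequencies.\<close>

lemma distr_lborel_pow_uminus:
  "distr (lborel_pow N) (lborel_pow N) (\<lambda>w. \<lambda>q\<in>{..<N}. - w q) = lborel_pow N"
proof (rule lborel_product.PiM_eqI)
  fix A :: "nat \<Rightarrow> real set"
  assume A: "\<And>i. i \<in> {..<N} \<Longrightarrow> A i \<in> sets lborel"
  let ?T = "\<lambda>w. \<lambda>q\<in>{..<N}. - w q :: real"
  have pre: "?T -` Pi\<^sub>E {..<N} A \<inter> space (lborel_pow N) = Pi\<^sub>E {..<N} (\<lambda>i. uminus -` A i)"
    by (auto simp: space_PiM PiE_iff extensional_def)
  have "uminus -` A i \<in> sets lborel" if "i < N" for i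
    using measurable_sets[of uminus lborel lborel "A i"] A[of i] that by simp
  moreover have "emeasure lborel (uminus -` A i) = emeasure lborel (A i)" if "i < N" for i
    using emeasure_distr[of uminus lborel borel "A i"] A[of i] that
    by (simp add: lborel_distr_uminus)
  ultimately have "emeasure (lborel_pow N) (Pi\<^sub>E {..<N} (\<lambda>i. uminus -` A i)) =
      (\<Prod>i<N. emeasure lborel (A i))"
    by (subst lborel_product.emeasure_PiM) auto
  with pre show "emeasure (distr (lborel_pow N) (lborel_pow N) ?T) (Pi\<^sub>E {..<N} A) =
      (\<Prod>i<N. emeasure lborel (A i))"
    using A by (simp add: emeasure_distr sets_PiM_I_finite lborel_product.emeasure_PiM)
qed auto

lemma AE_lborel_pow_uminus:
  assumes "AE w in lborel_pow N. Q w"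
  shows "AE w in lborel_pow N. Q (\<lambda>q\<in>{..<N}. - w q)"
  using assms
  by (intro AE_distrD[OF measurable_lborel_pow_uminus]) (simp only: distr_lborel_pow_uminus)

lemma integrable_cube_indicator:
  "integrable (lborel_pow N) (\<lambda>w. \<Prod>q<N. indicator {a..b} (w q) :: real)"
  by (rule lborel_product.product_integrable_prod)
    (auto intro!: integrable_real_indicator simp: emeasure_lborel_Icc_eq)

section \<open>Filter responses: measurability and a.e. bounds\<close>

text \<open>The band is bounded, so at each point the symmetric partial sums of the periodization
  are eventually constant; their pointwise limit is therefore measurable.\<close>

lemma shannon_measurable [measurable]: "shannon M m \<in> borel_measurable borel"
proof (rule borel_measurable_LIMSEQ_metric)
  let ?f = "\<lambda>w (l :: int). indicator (shannon_band M m) (w - 2 * pi * of_int l) :: complex"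
  show "(\<lambda>w. \<Sum>l\<in>{- int L..int L}. ?f w l) \<in> borel_measurable borel" for L
    unfolding shannon_band_def by measurable
  fix w :: real
  \<comment> \<open>The outer end of the band. If \<open>M = 0\<close>, division by zero makes
    \<open>R = 0\<close> and the band \<open>{0}\<close>, so the inclusion below still
    holds.\<close>
  define R where "R = real (m + 1) * pi / real M"
  have "0 \<le> real m * pi / real M" "real m * pi / real M \<le> R"
    unfolding R_def by (auto intro!: divide_right_mono)
  moreover have "{- b..- a} \<union> {a..b} \<subseteq> {- b..b}" if "0 \<le> a" "a \<le> b" for a b :: real
    using that by auto
  ultimately have R: "shannon_band M m \<subseteq> {- R..R}"
    unfolding shannon_band_def R_def by blast
  obtain L0 where L0: "\<bar>w\<bar> + R \<le> real L0" using real_arch_simple by blast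
  have "(\<Sum>l\<in>{- int L..int L}. ?f w l) = shannon M m w" if "L \<ge> L0" for L
  proof -
    have zero: "?f w l = 0" if l: "l \<notin> {- int L..int L}" for l
    proof -
      \<comment> \<open>The gain of 1 over \<open>L\<close> makes the final inequality strict, so
        the shifted point lies outside \<open>{- R..R}\<close>; the crude estimate
        \<open>2 * pi \<ge> 1\<close> is enough.\<close>
      have "real L + 1 \<le> \<bar>of_int l\<bar>" using l by auto
      also have "\<dots> \<le> \<bar>2 * pi * of_int l\<bar>"
        using pi_ge_two by (simp add: abs_mult mult_le_cancel_right1)
      finally have "\<bar>w - 2 * pi * of_int l\<bar> > R"
        using L0 \<open>L \<ge> L0\<close> by linarith
      then show ?thesis using R by (fastforce simp: indicator_def)
    qed
    have "shannon M m w = infsum (?f w) {- int L..int L}"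
      unfolding shannon_def by (rule infsum_cong_neutral) (use zero in auto)
    then show ?thesis by simp
  qed
  then show "(\<lambda>L. \<Sum>l\<in>{- int L..int L}. ?f w l) \<longlonglongrightarrow> shannon M m w"
    by (intro tendsto_eventually eventually_sequentiallyI[of L0])
qed

text \<open>Row \<open>m\<close> of the unitary matrix has Euclidean norm 1, and its entry in column
  0 is \<open>H m w\<close> itself.\<close>

lemma paraunitary_AE_le_1:
  assumes "paraunitary M H" and m: "m < M"
  shows "AE w in lborel. cmod (H m w) \<le> 1"
  using assms(1) unfolding paraunitary_def
proof eventually_elim
  case (elim w)
  let ?U = "\<lambda>q. H m (w + 2 * pi * real q / real M)"
  have "(\<Sum>q<M. ?U q * cnj (?U q)) = 1"
    using elim m by (simp add: unitary_matrix_def)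
  then have "complex_of_real (\<Sum>q<M. (cmod (?U q))\<^sup>2) = 1"
    by (simp only: of_real_sum complex_norm_square)
  then have "(\<Sum>q<M. (cmod (?U q))\<^sup>2) = 1" by (simp only: of_real_eq_1_iff)
  moreover have "(cmod (?U 0))\<^sup>2 \<le> (\<Sum>q<M. (cmod (?U q))\<^sup>2)"
    by (rule member_le_sum) (use m in auto)
  ultimately show ?case by (simp add: power_le_one_iff abs_square_le_1)
qed

section \<open>Packet transforms: measurability, bound and limit\<close>

lemma packet_FT_measurable:
  assumes "0 < M" and "\<And>m. m < M \<Longrightarrow> H m \<in> borel_measurable borel"
  shows "packet_FT M H j n \<in> borel_measurable borel"
proof -
  \<comment> \<open>A digit is a remainder modulo \<open>M\<close>, so it is a valid filter index as
    soon as \<open>0 < M\<close>.\<close>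
  have [measurable]: "H (packet_digit M j n l) \<in> borel_measurable borel" for l
    using assms by (simp add: packet_digit_def)
  show ?thesis unfolding packet_FT_def by measurable
qed

text \<open>The factors are evaluated at dilated frequencies; the dilations
  \<open>M ^ (l - 1)\<close> are nonzero and so pull null sets back to null sets, and only
  \<open>j\<close> of these sets have to be united.\<close>

lemma AE_packet_digit:
  assumes M: "0 < M" and "\<And>m. m < M \<Longrightarrow> AE w in lborel. Q m w"
  shows "AE w in lborel. \<forall>l\<in>{1..j}. Q (packet_digit M j n l) (real (M ^ (l - 1)) * w)"
proof (rule AE_finite_allI)
  fix l assume "l \<in> {1..j}"
  have "AE w in lborel. Q (packet_digit M j n l) w"
    using assms by (simp add: packet_digit_def)
  from AE_lborel_affine[OF this, of "real (M ^ (l - 1))" 0]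
  show "AE w in lborel. Q (packet_digit M j n l) (real (M ^ (l - 1)) * w)"
    using M by simp
qed simp

lemma packet_FT_AE_bound:
  assumes M: "0 < M" and le: "\<And>m. m < M \<Longrightarrow> AE w in lborel. cmod (H m w) \<le> 1"
  shows "AE w in lborel.
    cmod (packet_FT M H j n w) \<le> real M powr (real j / 2) * indicator {- pi..pi} w"
proof -
  have "AE w in lborel. \<forall>l\<in>{1..j}. cmod (H (packet_digit M j n l) (real (M ^ (l - 1)) * w)) \<le> 1"
    by (rule AE_packet_digit[OF M le])
  then show ?thesis
  proof eventually_elim
    case (elim w)
    have "(\<Prod>l=1..j. cmod (H (packet_digit M j n l) (real (M ^ (l - 1)) * w))) \<le> 1"
      using elim by (intro prod_le_1) auto
    then show ?case
      by (auto simp: packet_FT_def norm_mult prod_norm[symmetric] indicator_def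
          intro!: mult_left_le)
  qed
qed

lemma packet_FT_AE_tendsto:
  assumes M: "0 < M" and lim: "\<And>m. m < M \<Longrightarrow> AE w in lborel. (\<lambda>r. H r m w) \<longlonglongrightarrow> G m w"
  shows "AE w in lborel. (\<lambda>r. packet_FT M (H r) j n w) \<longlonglongrightarrow> packet_FT M G j n w"
proof -
  have "AE w in lborel. \<forall>l\<in>{1..j}. (\<lambda>r. H r (packet_digit M j n l) (real (M ^ (l - 1)) * w))
      \<longlonglongrightarrow> G (packet_digit M j n l) (real (M ^ (l - 1)) * w)"
    by (rule AE_packet_digit[OF M lim])
  then show ?thesis
    by eventually_elim (auto simp: packet_FT_def intro!: tendsto_intros)
qed

section \<open>The phase-free integrand: domination and convergence\<close>

text \<open>The integrand of \<open>packet_cumulant_integral\<close> without its phase.\<close>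

definition packet_kernel ::
    "nat \<Rightarrow> ((nat \<Rightarrow> real) \<Rightarrow> complex) \<Rightarrow> (real \<Rightarrow> complex) \<Rightarrow> (nat \<Rightarrow> real) \<Rightarrow> complex" where
  "packet_kernel N g f w =
     g (\<lambda>q\<in>{..<N}. - w q) * f (- (\<Sum>q<N. w q)) * (\<Prod>q<N. f (w q))"

lemma packet_kernel_measurable:
  assumes [measurable]: "g \<in> borel_measurable (lborel_pow N)" "f \<in> borel_measurable borel"
  shows "packet_kernel N g f \<in> borel_measurable (lborel_pow N)"
proof -
  have [measurable]: "(\<lambda>w. g (\<lambda>q\<in>{..<N}. - w q)) \<in> borel_measurable (lborel_pow N)"
    by (rule measurable_compose[OF measurable_lborel_pow_uminus]) measurable
  show ?thesis unfolding packet_kernel_def by measurable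
qed

text \<open>Here \<open>N \<ge> 1\<close> matters: for \<open>N = 0\<close> the sum is the single
  point 0, about which an a.e. statement says nothing.\<close>

lemma AE_lborel_pow_neg_sum:
  assumes "AE x in lborel. Q x" and "N \<ge> 1"
  shows "AE w in lborel_pow N. Q (- (\<Sum>q<N. w q))"
  using AE_lborel_pow_linear[OF assms(1), of 0 N "\<lambda>_. - 1"] assms(2)
  by (simp add: sum_negf)

text \<open>The factor \<open>g\<close> contributes \<open>C\<close>, the factor at the negated sum
  contributes \<open>K\<close>, and the remaining \<open>N\<close> factors contribute
  \<open>K ^ N\<close> and confine \<open>w\<close> to the cube with side \<open>S\<close>. For
  bounded \<open>S\<close> this gives an integrable majorant.\<close>

lemma packet_kernel_AE_bound:
  assumes g: "AE w in lborel_pow N. cmod (g w) \<le> C" and N: "N \<ge> 1"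
    and f: "AE x in lborel. cmod (f x) \<le> K * indicator S x" and K: "0 \<le> K"
  shows "AE w in lborel_pow N.
    cmod (packet_kernel N g f w) \<le> C * K * (K ^ N * (\<Prod>q<N. indicator S (w q)))"
proof -
  have "AE w in lborel_pow N. \<forall>q\<in>{..<N}. cmod (f (w q)) \<le> K * indicator S (w q)"
    using AE_lborel_pow_component[OF f] by (intro AE_finite_allI) auto
  with AE_lborel_pow_uminus[OF g] AE_lborel_pow_neg_sum[OF f N] show ?thesis
  proof eventually_elim
    case (elim w)
    \<comment> \<open>The support of this factor is given up; the other factors already localize
      \<open>w\<close>.\<close>
    have "cmod (f (- (\<Sum>q<N. w q))) \<le> K"
      using elim(2) K by (cases "- (\<Sum>q<N. w q) \<in> S") auto
    moreover have "(\<Prod>q<N. cmod (f (w q))) \<le> (\<Prod>q<N. K * indicator S (w q))"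
      using elim(3) by (intro prod_mono) auto
    \<comment> \<open>Multiplying the estimates needs a nonnegative \<open>C\<close>, which follows
      because \<open>C\<close> bounds a norm at the present \<open>w\<close>.\<close>
    moreover have "0 \<le> C" using elim(1) norm_ge_zero order_trans by blast
    ultimately show ?case
      using elim(1) K unfolding packet_kernel_def
      by (simp add: norm_mult prod_norm[symmetric] prod.distrib)
         (intro mult_mono, auto intro!: prod_nonneg)
  qed
qed

lemma packet_kernel_AE_tendsto:
  assumes N: "N \<ge> 1" and f: "AE x in lborel. (\<lambda>r. f r x) \<longlonglongrightarrow> f' x"
  shows "AE w in lborel_pow N. (\<lambda>r. packet_kernel N g (f r) w) \<longlonglongrightarrow> packet_kernel N g f' w"
proof -
  have "AE w in lborel_pow N. \<forall>q\<in>{..<N}. (\<lambda>r. f r (w q)) \<longlonglongrightarrow> f' (w q)"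
    using AE_lborel_pow_component[OF f] by (intro AE_finite_allI) auto
  with AE_lborel_pow_neg_sum[OF f N] show ?thesis
    by eventually_elim (auto simp: packet_kernel_def intro!: tendsto_intros)
qed

section \<open>Uniform convergence of the cumulant integrals\<close>

text \<open>Both integrands carry the same unimodular phase, which factors out of their difference
  and disappears under the norm. The bound is thus free of \<open>k\<close>, which is the source of
  the uniformity in the lags.\<close>

lemma packet_cumulant_integral_dist:
  fixes N :: nat and k :: "nat \<Rightarrow> int"
  assumes 1: "integrable (lborel_pow N) (packet_kernel N g (packet_FT M H j n))"
    and 2: "integrable (lborel_pow N) (packet_kernel N g (packet_FT M G j n))"
  shows "dist (packet_cumulant_integral M H j n N g k) (packet_cumulant_integral M G j n N g k) \<le>
    1 / (2 * pi) ^ N * (\<integral>w. cmod (packet_kernel N g (packet_FT M H j n) w -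
      packet_kernel N g (packet_FT M G j n) w) \<partial>lborel_pow N)"
proof -
  let ?e = "\<lambda>w. exp (- \<i> * complex_of_real (real (M ^ j) * (\<Sum>q<N. of_int (k q) * w q)))"
  let ?F = "\<lambda>H w. ?e w * packet_kernel N g (packet_FT M H j n) w"
  have e: "cmod (?e w) = 1" for w by (simp add: norm_exp_eq_Re)
  have [measurable]: "?e \<in> borel_measurable (lborel_pow N)" by measurable
  have int: "integrable (lborel_pow N) (?F H)"
    if "integrable (lborel_pow N) (packet_kernel N g (packet_FT M H j n))" for H
    using that by (rule Bochner_Integration.integrable_bound)
      (use that in \<open>auto simp: norm_mult e\<close>)
  have eq: "packet_cumulant_integral M H j n N g k =
      complex_of_real (1 / (2 * pi) ^ N) * (\<integral>w. ?F H w \<partial>lborel_pow N)" for H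
    by (simp add: packet_cumulant_integral_def packet_kernel_def mult.assoc)
  \<comment> \<open>Merging the two integrals requires both integrands to be integrable, since a
    Bochner integral defaults to 0 otherwise.\<close>
  have "packet_cumulant_integral M H j n N g k - packet_cumulant_integral M G j n N g k =
      complex_of_real (1 / (2 * pi) ^ N) * (\<integral>w. ?F H w - ?F G w \<partial>lborel_pow N)"
    unfolding eq using int[OF 1] int[OF 2]
    by (simp only: Bochner_Integration.integral_diff right_diff_distrib)
  then have "dist (packet_cumulant_integral M H j n N g k) (packet_cumulant_integral M G j n N g k) =
      1 / (2 * pi) ^ N * cmod (\<integral>w. ?F H w - ?F G w \<partial>lborel_pow N)"
    by (simp only: dist_norm norm_mult norm_of_real) simp
  moreover have "1 / (2 * pi) ^ N * cmod (\<integral>w. ?F H w - ?F G w \<partial>lborel_pow N) \<le>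
      1 / (2 * pi) ^ N * (\<integral>w. cmod (?F H w - ?F G w) \<partial>lborel_pow N)"
    by (intro mult_left_mono integral_norm_bound) simp
  moreover have "cmod (?F H w - ?F G w) = cmod (packet_kernel N g (packet_FT M H j n) w -
      packet_kernel N g (packet_FT M G j n) w)" for w
    by (simp only: right_diff_distrib[symmetric] norm_mult e mult_1)
  ultimately show ?thesis by (simp only:)
qed

lemma packet_cumulant_integral_uniform_limit:
  fixes H :: "nat \<Rightarrow> nat \<Rightarrow> real \<Rightarrow> complex"
  assumes M: "0 < M" and N: "N \<ge> 1" and g: "in_L_infinity (lborel_pow N) g"
    and H: "\<And>r m. m < M \<Longrightarrow> H r m \<in> borel_measurable borel"
    and G: "\<And>m. m < M \<Longrightarrow> G m \<in> borel_measurable borel"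
    and le: "\<And>r m. m < M \<Longrightarrow> AE w in lborel. cmod (H r m w) \<le> 1"
    and lim: "\<And>m. m < M \<Longrightarrow> AE w in lborel. (\<lambda>r. H r m w) \<longlonglongrightarrow> G m w"
  shows "uniform_limit UNIV (\<lambda>r. packet_cumulant_integral M (H r) j n N g)
    (packet_cumulant_integral M G j n N g) sequentially"
proof -
  from g obtain C where gm: "g \<in> borel_measurable (lborel_pow N)"
    and C: "AE w in lborel_pow N. cmod (g w) \<le> C"
    unfolding in_L_infinity_def by blast
  define K where "K = real M powr (real j / 2)"
  define \<Phi> where "\<Phi> H = packet_kernel N g (packet_FT M H j n)" for H
  \<comment> \<open>The majorant of \<open>packet_kernel_AE_bound\<close> for the cube with side
    \<open>{- pi..pi}\<close>.\<close>
  define b where "b w = C * K * (K ^ N * (\<Prod>q<N. indicator {- pi..pi} (w q)))"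
    for w :: "nat \<Rightarrow> real"
  have b: "integrable (lborel_pow N) b"
    unfolding b_def by (intro integrable_mult_right integrable_cube_indicator)
  \<comment> \<open>The limit inherits the bound outside a countable union of null sets. For the
    Shannon responses the bound is genuinely only a.e.: both ends of the top band meet at
    \<open>pi\<close>, where \<open>shannon M (M - 1)\<close> takes the value 2.\<close>
  have leG: "AE w in lborel. cmod (G m w) \<le> 1" if m: "m < M" for m
  proof -
    have "AE w in lborel. \<forall>r. cmod (H r m w) \<le> 1"
      using le[OF m] by (simp add: AE_all_countable)
    with lim[OF m] show ?thesis
      by eventually_elim (rule LIMSEQ_le_const2[OF tendsto_norm], auto)
  qed
  have bound: "AE w in lborel_pow N. cmod (\<Phi> H w) \<le> b w"
    if "\<And>m. m < M \<Longrightarrow> AE w in lborel. cmod (H m w) \<le> 1" for H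
    unfolding \<Phi>_def b_def K_def
    by (rule packet_kernel_AE_bound[OF C N packet_FT_AE_bound[OF M that]]) auto
  have boundH: "AE w in lborel_pow N. cmod (\<Phi> (H r) w) \<le> b w" for r
    by (rule bound[OF le])
  have boundG: "AE w in lborel_pow N. cmod (\<Phi> G w) \<le> b w"
    by (rule bound[OF leG])
  have meas: "\<Phi> H \<in> borel_measurable (lborel_pow N)"
    if "\<And>m. m < M \<Longrightarrow> H m \<in> borel_measurable borel" for H
    unfolding \<Phi>_def by (intro packet_kernel_measurable gm packet_FT_measurable M that)
  have tendsto: "AE w in lborel_pow N. (\<lambda>r. \<Phi> (H r) w) \<longlonglongrightarrow> \<Phi> G w"
    unfolding \<Phi>_def by (intro packet_kernel_AE_tendsto packet_FT_AE_tendsto N M lim)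
  have [measurable]: "\<Phi> (H r) \<in> borel_measurable (lborel_pow N)"
    "\<Phi> G \<in> borel_measurable (lborel_pow N)" for r
    using meas H G by auto
  have integrable: "integrable (lborel_pow N) (\<Phi> (H r))" "integrable (lborel_pow N) (\<Phi> G)" for r
  proof -
    show "integrable (lborel_pow N) (\<Phi> (H r))"
      by (rule Bochner_Integration.integrable_bound[OF b])
        (measurable, use boundH[of r] in \<open>auto elim!: eventually_mono\<close>)
    show "integrable (lborel_pow N) (\<Phi> G)"
      by (rule Bochner_Integration.integrable_bound[OF b])
        (measurable, use boundG in \<open>auto elim!: eventually_mono\<close>)
  qed
  have "(\<lambda>r. \<integral>w. cmod (\<Phi> (H r) w - \<Phi> G w) \<partial>lborel_pow N) \<longlonglongrightarrow> (\<integral>w. 0 \<partial>lborel_pow N)"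
  \<comment> \<open>Each of the two kernels is dominated by \<open>b\<close>, hence their difference
    by \<open>2 * b\<close>.\<close>
  proof (rule integral_dominated_convergence[where w = "\<lambda>w. 2 * b w"])
    show "AE w in lborel_pow N. (\<lambda>r. cmod (\<Phi> (H r) w - \<Phi> G w)) \<longlonglongrightarrow> 0"
      using tendsto by eventually_elim (simp add: LIM_zero tendsto_norm_zero)
    show "AE w in lborel_pow N. norm (cmod (\<Phi> (H r) w - \<Phi> G w)) \<le> 2 * b w" for r
      using boundH[of r] boundG
    proof eventually_elim
      case (elim w)
      then show ?case using norm_triangle_ineq4[of "\<Phi> (H r) w" "\<Phi> G w"] by simp
    qed
  qed (use b in auto)
  then have "(\<lambda>r. 1 / (2 * pi) ^ N * (\<integral>w. cmod (\<Phi> (H r) w - \<Phi> G w) \<partial>lborel_pow N)) \<longlonglongrightarrow> 0"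
    using tendsto_mult_right_zero by auto
  then have "\<forall>\<^sub>F r in sequentially.
      1 / (2 * pi) ^ N * (\<integral>w. cmod (\<Phi> (H r) w - \<Phi> G w) \<partial>lborel_pow N) < e" if "e > 0" for e
    using that by (rule order_tendstoD)
  \<comment> \<open>The right side depends on \<open>r\<close> but not on \<open>k\<close>, so one
    threshold for \<open>r\<close> serves all lags.\<close>
  moreover have "dist (packet_cumulant_integral M (H r) j n N g k)
      (packet_cumulant_integral M G j n N g k) \<le>
      1 / (2 * pi) ^ N * (\<integral>w. cmod (\<Phi> (H r) w - \<Phi> G w) \<partial>lborel_pow N)" for r k
    using packet_cumulant_integral_dist integrable unfolding \<Phi>_def by blast
  ultimately show ?thesis
    unfolding uniform_limit_iff by (blast intro: eventually_mono le_less_trans)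
qed

section \<open>Uniformity over the nodes and conclusion\<close>

text \<open>Finitely many eventual statements, one for each element of \<open>A\<close>, hold
  together eventually.\<close>

lemma uniform_limit_finite_Times:
  assumes "finite A" and "\<And>a. a \<in> A \<Longrightarrow> uniform_limit B (\<lambda>r. f r a) (l a) F"
  shows "uniform_limit (A \<times> B) (\<lambda>r (a, b). f r a b) (\<lambda>(a, b). l a b) F"
  using assms unfolding uniform_limit_iff
  by (auto simp: split_beta Ball_def[symmetric] eventually_ball_finite_distrib)

theorem theorem4:
  fixes P :: "'a measure"
    and X :: "real \<Rightarrow> 'a \<Rightarrow> real"
    and \<gamma> :: "nat \<Rightarrow> (nat \<Rightarrow> real) \<Rightarrow> complex"
    and M :: nat
    and h :: "nat \<Rightarrow> nat \<Rightarrow> int \<Rightarrow> real"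
    and H :: "nat \<Rightarrow> nat \<Rightarrow> real \<Rightarrow> complex"
    and c :: "nat \<Rightarrow> nat \<Rightarrow> nat \<Rightarrow> int \<Rightarrow> 'a \<Rightarrow> real"
    and cS :: "nat \<Rightarrow> nat \<Rightarrow> int \<Rightarrow> 'a \<Rightarrow> real"
  assumes M: "M \<ge> 2"
    and prob: "prob_space P"
    and second_order: "second_order_process P X"
    and centred: "centred P X"
    and stationary: "strictly_stationary P X"
    and continuous: "continuous_in_quadratic_mean P X"
    and cumulants: "finite_cumulants P X"
    and polyspectrum: "\<And>N. N \<ge> 1 \<Longrightarrow> is_polyspectrum P X N (\<gamma> N)"
    and bounded: "\<And>N. N \<ge> 1 \<Longrightarrow> in_L_infinity (lborel_pow N) (\<gamma> N)"
    and support: "AE w in lborel_pow 1. w 0 \<notin> {- pi..pi} \<longrightarrow> \<gamma> 1 w = 0"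
    and response: "\<And>r m. m < M \<Longrightarrow> frequency_response M (h r m) (H r m)"
    and paraunitary: "\<And>r. paraunitary M (H r)"
    and limit: "\<And>m. m < M \<Longrightarrow> AE w in lborel. (\<lambda>r. H r m w) \<longlonglongrightarrow> shannon M m w"
    and coefficients: "\<And>r j n. n < M ^ j \<Longrightarrow> packet_coefficients P X M (H r) j n (c r j n)"
    and coefficients_S: "\<And>j n. n < M ^ j \<Longrightarrow> packet_coefficients P X M (shannon M) j n (cS j n)"
    and finite_cum: "\<And>r j n. n < M ^ j \<Longrightarrow> finite_cumulants P (c r j n)"
    and finite_cum_S: "\<And>j n. n < M ^ j \<Longrightarrow> finite_cumulants P (cS j n)"
    and formula: "\<And>r j n N k. n < M ^ j \<Longrightarrow> N \<ge> 1 \<Longrightarrow>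
          complex_of_real (lag_cumulant P (c r j n) N k) =
          packet_cumulant_integral M (H r) j n N (\<gamma> N) k"
    and formula_S: "\<And>j n N k. n < M ^ j \<Longrightarrow> N \<ge> 1 \<Longrightarrow>
          complex_of_real (lag_cumulant P (cS j n) N k) =
          packet_cumulant_integral M (shannon M) j n N (\<gamma> N) k"
  shows "\<forall>j. \<forall>N\<ge>1.
           uniform_limit ({..<M ^ j} \<times> UNIV)
             (\<lambda>r (n, k). lag_cumulant P (c r j n) N k)
             (\<lambda>(n, k). lag_cumulant P (cS j n) N k)
             sequentially"
\<comment> \<open>Level \<open>j\<close> has only \<open>M ^ j\<close> nodes, so it is enough to be
  uniform in \<open>k\<close> at a fixed node; finiteness of the node set is left to the closing
  \<open>simp\<close>.\<close>
proof (intro allI impI uniform_limit_finite_Times)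
  fix j N n :: nat
  assume N: "N \<ge> 1" and "n \<in> {..<M ^ j}"
  then have n: "n < M ^ j" by simp
  have "uniform_limit UNIV (\<lambda>r. packet_cumulant_integral M (H r) j n N (\<gamma> N))
      (packet_cumulant_integral M (shannon M) j n N (\<gamma> N)) sequentially"
  proof (rule packet_cumulant_integral_uniform_limit)
    show "H r m \<in> borel_measurable borel" if "m < M" for r m
      using response[OF that] by (simp add: frequency_response_def)
  qed (use M N bounded[OF N] paraunitary_AE_le_1[OF paraunitary] limit in auto)
  then show "uniform_limit UNIV (\<lambda>r. lag_cumulant P (c r j n) N)
      (lag_cumulant P (cS j n) N) sequentially"
    \<comment> \<open>The cumulant formulas are read from right to left, and the embedding of the
      reals into the complex numbers is isometric, so the complex limit is already the real
      one.\<close>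
    by (simp add: uniform_limit_iff formula[OF n N, symmetric] formula_S[OF n N, symmetric]
        dist_of_real)
qed simp

end
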